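(* Let $G$ be a finite simple undirected graph and let $q$ be a prime power. There exists a positive integer $r$ such that for each integer $d\ge r$ there exists a monic polynomial $F_d\in\mathbb{F}_q[x]$ satisfying: (1) $\omega(F_d)=d$; (2) $G$ is an induced subgraph of the unitary Cayley graph $G_{F_d}(\{1\})$.
   Context: $\omega(h)$ denotes the number of distinct monic irreducible factors of $h$. The unitary Cayley graph $G_{F}(\{1\})$ is the graph with vertex set the ring $\mathbb{F}_q[x]/(F)$ in which $u,v$ are adjacent iff $\gcd(u-v,F)=1$, i.e. iff $u-v$ is a unit. "$G_1$ is an induced subgraph of $G_2$" means that there is an injective map $V(G_1)\to V(G_2)$ such that two vertices of $G_1$ are adjacent if and only if their images are adjacent in $G_2$. *)

theory Defs
  imports "HOL-Computational_Algebra.Polynomial_Factorial" "HOL-Number_Theory.Number_Theory" "Graph_Theory.Pair_Digraph"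
begin

definition omega :: "'a::field poly \<Rightarrow> nat" where
  "omega h = card {p. lead_coeff p = 1 \<and> irreducible p \<and> p dvd h}"

text \<open>Elements of the quotient ring \<open>K[x]/(F)\<close> are congruence classes of polynomials.\<close>

definition mod_class_rel :: "'a::field poly \<Rightarrow> 'a poly rel" where
  "mod_class_rel F = {(u, v). [u = v] (mod F)}"

definition residue_class :: "'a::field poly \<Rightarrow> 'a poly \<Rightarrow> 'a poly set" where
  "residue_class F u = mod_class_rel F `` {u}"

definition residue_classes :: "'a::field poly \<Rightarrow> 'a poly set set" where
  "residue_classes F = UNIV // mod_class_rel F"

text \<open>
  Adjacency is expressed with \<open>coprime\<close> rather than \<open>gcd (u - v) F = 1\<close>, because the library
  provides \<open>gcd\<close> on polynomials only over coefficient types of class \<open>field_gcd\<close>, whereas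
  coprimality is available over every field. The choice of representatives is irrelevant
  (lemma \<open>parcs_unitary_cayley_graph_iff\<close>), and adjacency means exactly that the difference is
  invertible modulo \<open>F\<close> (lemma \<open>parcs_unitary_cayley_graph_iff_unit\<close>).
\<close>

definition unitary_cayley_graph :: "'a::field poly \<Rightarrow> 'a poly set pair_pre_digraph" where
  "unitary_cayley_graph F =
     \<lparr> pverts = residue_classes F,
       parcs = {(residue_class F u, residue_class F v) | u v. coprime (u - v) F} \<rparr>"

definition embeds_as_induced_subgraph ::
  "'v pair_pre_digraph \<Rightarrow> 'w pair_pre_digraph \<Rightarrow> bool" where
  "embeds_as_induced_subgraph G H \<longleftrightarrow>
     (\<exists>f. inj_on f (pverts G) \<and> f ` pverts G \<subseteq> pverts H \<and>
          (\<forall>u\<in>pverts G. \<forall>v\<in>pverts G. (u, v) \<in> parcs G \<longleftrightarrow> (f u, f v) \<in> parcs H))"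

lemma equiv_mod_class_rel: "equiv UNIV (mod_class_rel F)"
  by (rule equivI) (auto simp: mod_class_rel_def refl_on_def sym_def trans_def
      intro: cong_sym cong_trans)

lemma residue_class_eq_iff: "residue_class F u = residue_class F v \<longleftrightarrow> [u = v] (mod F)"
  unfolding residue_class_def
  using eq_equiv_class_iff[OF equiv_mod_class_rel, of u v F] by (simp add: mod_class_rel_def)

lemma residue_class_in_residue_classes: "residue_class F u \<in> residue_classes F"
  by (simp add: residue_class_def residue_classes_def quotientI)

lemma residue_classes_eq_range: "residue_classes F = range (residue_class F)"
  by (auto simp: residue_class_def residue_classes_def quotient_def)

lemma parcs_unitary_cayley_graph_iff:
  "(residue_class F u, residue_class F v) \<in> parcs (unitary_cayley_graph F) \<longleftrightarrow> coprime (u - v) F"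
proof
  assume "(residue_class F u, residue_class F v) \<in> parcs (unitary_cayley_graph F)"
  then obtain u' v' where 1: "[u = u'] (mod F)" "[v = v'] (mod F)" and 2: "coprime (u' - v') F"
    by (auto simp: unitary_cayley_graph_def residue_class_eq_iff)
  from 1 have "[u - v = u' - v'] (mod F)"
    by (rule cong_diff)
  then have "F dvd (u - v) - (u' - v')"
    by (simp add: cong_iff_dvd_diff)
  then obtain k where k: "(u - v) - (u' - v') = F * k" ..
  show "coprime (u - v) F"
  proof (rule coprimeI)
    fix c assume c: "c dvd u - v" "c dvd F"
    then have "c dvd F * k" by simp
    moreover have "u' - v' = (u - v) - F * k" using k by (simp add: algebra_simps)
    ultimately have "c dvd u' - v'" using c(1) by simp
    then show "is_unit c" using 2 c(2) coprime_common_divisor by blast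
  qed
next
  assume "coprime (u - v) F"
  then show "(residue_class F u, residue_class F v) \<in> parcs (unitary_cayley_graph F)"
    by (auto simp: unitary_cayley_graph_def)
qed

lemma coprime_poly_imp_bezout:
  fixes a b :: "'a::field poly"
  assumes "coprime a b"
  shows "\<exists>s t. s * a + t * b = 1"
  using assms
proof (induction "if b = 0 then 0 else Suc (degree b)" arbitrary: a b rule: less_induct)
  case less
  show ?case
  proof (cases "b = 0")
    case True
    with less.prems have "a dvd 1" by simp
    then obtain s where "1 = a * s" ..
    then have "s * a + 0 * b = 1" by (simp add: mult.commute)
    then show ?thesis by blast
  next
    case False
    have cop: "coprime b (a mod b)"
      using less.prems by (auto simp: coprime_def dvd_mod_iff)
    have "(if a mod b = 0 then 0 else Suc (degree (a mod b))) < Suc (degree b)"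
      using degree_mod_less[OF False, of a] by auto
    then obtain s t where st: "s * b + t * (a mod b) = 1"
      using less.hyps[OF _ cop] False by auto
    have "t * a + (s - t * (a div b)) * b = s * b + t * (a - a div b * b)"
      by (simp add: algebra_simps)
    also have "a - a div b * b = a mod b"
      by (simp add: minus_div_mult_eq_mod)
    finally show ?thesis using st by metis
  qed
qed

lemma parcs_unitary_cayley_graph_iff_unit:
  "(residue_class F u, residue_class F v) \<in> parcs (unitary_cayley_graph F) \<longleftrightarrow>
     (\<exists>w. [(u - v) * w = 1] (mod F))"
proof -
  have "coprime (u - v) F \<longleftrightarrow> (\<exists>w. [(u - v) * w = 1] (mod F))"
  proof
    assume "coprime (u - v) F"
    then obtain s t where "s * (u - v) + t * F = 1"
      using coprime_poly_imp_bezout by blast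
    then have "(u - v) * s - 1 = F * (- t)"
      by (simp add: algebra_simps)
    then have "[(u - v) * s = 1] (mod F)"
      by (metis cong_iff_dvd_diff dvd_triv_left)
    then show "\<exists>w. [(u - v) * w = 1] (mod F)" ..
  next
    assume "\<exists>w. [(u - v) * w = 1] (mod F)"
    then obtain w where "F dvd (u - v) * w - 1"
      by (auto simp: cong_iff_dvd_diff)
    then show "coprime (u - v) F"
      by (meson coprimeI dvd_diff_right_iff dvd_mult2 dvd_trans)
  qed
  then show ?thesis by (simp add: parcs_unitary_cayley_graph_iff)
qed

end

theory Submission
  imports Defs
begin

text \<open>
  Let \<open>F\<close> be the product of a set \<open>S\<close> of monic irreducible polynomials. By the Chinese remainder
  theorem a vertex of the unitary Cayley graph of \<open>F\<close> is a family of residues, one modulo each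
  \<open>p \<in> S\<close>, and two vertices are adjacent iff their residues differ modulo every \<open>p \<in> S\<close>. Each prime
  can therefore be used to destroy one unwanted adjacency. Give the vertices of \<open>G\<close> distinct
  polynomials \<open>c v\<close> as colours, and take only primes modulo which these colours stay distinct;
  there are infinitely many of them (\<open>infinite_monic_irreducible_not_dvd\<close>). Distribute the primes
  in \<open>S\<close> over the non-adjacent ordered pairs \<open>(a, b)\<close> so that every pair receives at least one
  prime. Modulo a prime assigned to \<open>(a, b)\<close>, every vertex keeps its colour, except that \<open>b\<close> takes
  the colour of \<open>a\<close>. Non-adjacent vertices then agree modulo some prime, whereas adjacent vertices
  differ modulo all primes.

  The diagonal pairs \<open>(v, v)\<close> count as non-adjacent. They modify no colour, so a prime assigned
  to such a pair separates all vertices; this gives injectivity. Since several primes may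
  be assigned to the same pair, any number of primes that is at least the number of pairs will do.
\<close>

section \<open>Monic irreducible polynomials over a field\<close>

abbreviation monic_irreducible :: "'a::field poly \<Rightarrow> bool" where
  "monic_irreducible p \<equiv> lead_coeff p = 1 \<and> irreducible p"

lemma monic_irreducible_dvd_imp_eq:
  fixes p q :: "'a::field poly"
  assumes p: "monic_irreducible p" and q: "monic_irreducible q" and "p dvd q"
  shows "p = q"
proof -
  obtain k where k: "q = p * k" using \<open>p dvd q\<close> ..
  have "is_unit k"
    using irreducibleD[of q p k] p q k by (auto simp: irreducible_not_unit)
  then obtain c where c: "k = [:c:]"
    by (auto elim: is_unit_polyE)
  have "lead_coeff k = 1"
    using k p q by (metis lead_coeff_mult mult_1)
  then have "c = 1" using c by simp
  then show ?thesis using k c by (simp add: pCons_one)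
qed

lemma monic_irreducible_divisor_exists:
  fixes h :: "'a::field poly"
  assumes "h \<noteq> 0" "\<not> is_unit h"
  obtains p where "monic_irreducible p" "p dvd h"
  using assms
proof (induction "degree h" arbitrary: h thesis rule: less_induct)
  case less
  show ?case
  proof (cases "irreducible h")
    case True
    define c where "c = inverse (lead_coeff h)"
    have c: "c \<noteq> 0" "c * lead_coeff h = 1" using less.prems by (auto simp: c_def)
    have h: "h = [:inverse c:] * Polynomial.smult c h" using c by simp
    have u: "is_unit [:inverse c:]" using c by (simp add: is_unit_pCons_iff)
    have "irreducible (Polynomial.smult c h)"
      using True irreducible_mult_unit_left[OF u, of "Polynomial.smult c h"] h by simp
    moreover have "lead_coeff (Polynomial.smult c h) = 1" using c by simp
    moreover have "Polynomial.smult c h dvd h" using c by (simp add: smult_dvd_iff)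
    ultimately show ?thesis using less.prems(1) by blast
  next
    case False
    then obtain a b where ab: "h = a * b" "\<not> is_unit a" "\<not> is_unit b"
      using less.prems by (auto simp: irreducible_def)
    then have nz: "a \<noteq> 0" "b \<noteq> 0" using less.prems by auto
    have "degree b > 0" using ab nz by (auto simp: is_unit_iff_degree)
    then have "degree a < degree h" using ab nz by (simp add: degree_mult_eq)
    then obtain p where "monic_irreducible p" "p dvd a"
      using less.hyps[of a] ab nz by blast
    then show ?thesis using less.prems(1)[of p] ab by simp
  qed
qed

lemma monic_irreducible_dvd_prod_imp_mem:
  fixes q :: "'a::field poly"
  assumes "finite S" "\<And>p. p \<in> S \<Longrightarrow> monic_irreducible p"
    and q: "monic_irreducible q" and "q dvd \<Prod>S"
  shows "q \<in> S"
  using assms(1,2,4)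
proof (induction S rule: finite_induct)
  case empty
  then show ?case using q by (auto simp: irreducible_not_unit)
next
  case (insert p S)
  have "prime_elem q" using q by (blast intro: field_poly_irreducible_imp_prime)
  then have "q dvd p \<or> q dvd \<Prod>S"
    using insert by (simp add: prime_elem_dvd_mult_iff)
  then show ?case
    using insert.IH insert.prems(1) monic_irreducible_dvd_imp_eq[OF q] by auto
qed

lemma omega_prod_monic_irreducible:
  fixes S :: "'a::field poly set"
  assumes "finite S" "\<And>p. p \<in> S \<Longrightarrow> monic_irreducible p"
  shows "omega (\<Prod>S) = card S"
proof -
  have "p dvd \<Prod>S" if "p \<in> S" for p
    using dvd_prodI[OF assms(1) that, of "\<lambda>p. p"] .
  then have "{p. lead_coeff p = 1 \<and> irreducible p \<and> p dvd \<Prod>S} = S"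
    using assms(2) monic_irreducible_dvd_prod_imp_mem[OF assms] by blast
  then show ?thesis by (simp add: omega_def)
qed

lemma coprime_prod_monic_irreducible_iff:
  fixes x :: "'a::field poly"
  assumes "finite S" "\<And>p. p \<in> S \<Longrightarrow> monic_irreducible p"
  shows "coprime x (\<Prod>S) \<longleftrightarrow> (\<forall>p\<in>S. \<not> p dvd x)"
proof
  assume "coprime x (\<Prod>S)"
  then show "\<forall>p\<in>S. \<not> p dvd x"
    using assms dvd_prodI[OF assms(1), of _ "\<lambda>p. p"]
    by (meson coprime_common_divisor irreducible_not_unit)
next
  assume *: "\<forall>p\<in>S. \<not> p dvd x"
  have nz: "\<Prod>S \<noteq> 0" using assms(2)[of 0] assms(1) by auto
  show "coprime x (\<Prod>S)"
  proof (rule coprimeI, rule ccontr)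
    fix g assume g: "g dvd x" "g dvd \<Prod>S" "\<not> is_unit g"
    then have "g \<noteq> 0" using nz by auto
    then obtain p where "monic_irreducible p" "p dvd g"
      using monic_irreducible_divisor_exists g(3) by blast
    then show False
      using monic_irreducible_dvd_prod_imp_mem[OF assms] g * by (meson dvd_trans)
  qed
qed

text \<open>
  Euclid's argument: if only finitely many primes did not divide \<open>h\<close>, then a prime divisor of one plus a
  multiple of \<open>h\<close> and of all these primes would be a further one.
\<close>

lemma infinite_monic_irreducible_not_dvd:
  fixes h :: "'a::field poly"
  assumes "h \<noteq> 0"
  shows "infinite {p. monic_irreducible p \<and> \<not> p dvd h}" (is "infinite ?A")
proof
  assume fin: "finite ?A"
  \<comment> \<open>The factor \<open>X\<close> makes \<open>1 + N\<close> non-constant even when \<open>h * \<Prod>?A\<close> is constant.\<close>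
  define N where "N = [:0, 1:] * (h * \<Prod>?A)"
  have "\<Prod>?A \<noteq> 0" using fin by auto
  then have "degree N > 0"
    using assms unfolding N_def by (subst degree_mult_eq) auto
  then have deg: "degree (1 + N) > 0" by (simp add: degree_add_eq_right)
  then have nz: "1 + N \<noteq> 0" by auto
  then have "\<not> is_unit (1 + N)" using deg is_unit_iff_degree[OF nz] by simp
  with nz obtain p where p: "monic_irreducible p" "p dvd 1 + N"
    by (rule monic_irreducible_divisor_exists)
  have not_dvd: "\<not> p dvd N"
    using p by (metis dvd_add_left_iff irreducible_not_unit)
  then have "\<not> p dvd h" by (auto simp: N_def simp del: mult_pCons_left)
  then have "p \<in> ?A" using p by blast
  then have "p dvd \<Prod>?A" using fin dvd_prodI[of ?A p "\<lambda>p. p"] by blast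
  then show False using not_dvd by (simp add: N_def del: mult_pCons_left)
qed

lemma chinese_remainder_monic_irreducible:
  fixes S :: "'a::field poly set" and c :: "'a poly \<Rightarrow> 'a poly"
  assumes "finite S" "\<And>p. p \<in> S \<Longrightarrow> monic_irreducible p"
  obtains u where "\<And>p. p \<in> S \<Longrightarrow> p dvd u - c p"
  using assms
proof (induction S arbitrary: thesis rule: finite_induct)
  case empty
  then show ?case by simp
next
  case (insert p S)
  obtain u where u: "q dvd u - c q" if "q \<in> S" for q
    using insert.IH insert.prems(2) by blast
  have "\<not> q dvd p" if "q \<in> S" for q
    using monic_irreducible_dvd_imp_eq[of q p] insert.prems(2) insert.hyps(2) that by blast
  then have "coprime p (\<Prod>S)"
    using insert by (subst coprime_prod_monic_irreducible_iff) auto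
  then obtain s t where st: "s * p + t * \<Prod>S = 1"
    using coprime_poly_imp_bezout by blast
  \<comment> \<open>\<open>t * \<Prod>S\<close> is \<open>1\<close> modulo \<open>p\<close> and \<open>0\<close> modulo the primes in \<open>S\<close>.\<close>
  define w where "w = u + (c p - u) * (t * \<Prod>S)"
  have "w - c p = p * ((u - c p) * s)"
  proof -
    have "w - c p = (u - c p) * (1 - t * \<Prod>S)" unfolding w_def by (simp add: algebra_simps)
    also have "1 - t * \<Prod>S = s * p" by (simp flip: st)
    finally show ?thesis by (simp add: mult_ac)
  qed
  then have "p dvd w - c p" by simp
  moreover have "q dvd w - c q" if "q \<in> S" for q
  proof -
    have "q dvd \<Prod>S" using insert.hyps(1) that dvd_prodI[of S q "\<lambda>p. p"] by blast
    moreover have "w - c q = (u - c q) + (c p - u) * (t * \<Prod>S)" by (simp add: w_def)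
    ultimately show ?thesis using u[OF that] by (metis dvd_add dvd_mult)
  qed
  ultimately show ?case using insert.prems(1)[of w] by blast
qed

section \<open>Embedding a graph\<close>

lemma ex_inj_on_poly:
  assumes "finite V"
  obtains c :: "'v \<Rightarrow> 'a::field poly" where "inj_on c V"
proof -
  obtain e :: "'v \<Rightarrow> nat" where e: "inj_on e V"
    using finite_imp_inj_to_nat_seg[OF assms] by blast
  have "inj_on (\<lambda>v. Polynomial.monom (1::'a) (e v)) V"
    using e by (auto simp: inj_on_def monom_eq_iff')
  then show thesis by (rule that)
qed

lemma finite_surj_of_card_le:
  assumes "finite A" "A \<noteq> {}" "finite B" "card A \<le> card B"
  obtains g where "g ` B = A"
proof -
  obtain e where e: "inj_on e A" "e ` A \<subseteq> B"
    using card_le_inj[OF assms(1,3,4)] by blast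
  obtain a where a: "a \<in> A" using assms(2) by blast
  define g where "g y = (if y \<in> e ` A then inv_into A e y else a)" for y
  have "x \<in> g ` B" if "x \<in> A" for x
  proof
    show "x = g (e x)" using e that by (simp add: g_def)
    show "e x \<in> B" using e that by blast
  qed
  moreover have "g y \<in> A" for y by (auto simp: g_def a inv_into_into)
  ultimately show thesis using that[of g] by blast
qed

text \<open>
  Modulo \<open>p\<close>, the only distinct vertices with equal residues are the two components of \<open>g p\<close>. As
  adjacency is symmetric, an arc in either direction is never among these pairs, so no prime merges
  it; every non-arc is merged by the primes assigned to it. The primes assigned to the diagonal
  pair \<open>(v, v)\<close> show that the residue class of \<open>v\<close> is shared with no other vertex.
\<close>

lemma embeds_in_unitary_cayley_graph:
  fixes S :: "'a::field poly set" and c :: "'v \<Rightarrow> 'a poly" and g :: "'a poly \<Rightarrow> 'v \<times> 'v"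
  assumes G: "pair_graph G"
    and S: "finite S" "\<And>p. p \<in> S \<Longrightarrow> monic_irreducible p"
    and distinct: "\<And>p v w. p \<in> S \<Longrightarrow> v \<in> pverts G \<Longrightarrow> w \<in> pverts G \<Longrightarrow> v \<noteq> w \<Longrightarrow>
                     \<not> p dvd c v - c w"
    and non_arc: "\<And>p. p \<in> S \<Longrightarrow> g p \<notin> parcs G"
    and in_verts: "\<And>p. p \<in> S \<Longrightarrow> fst (g p) = snd (g p) \<or> g p \<in> pverts G \<times> pverts G"
    and all: "(pverts G \<times> pverts G) - parcs G \<subseteq> g ` S"
  shows "embeds_as_induced_subgraph G (unitary_cayley_graph (\<Prod>S))"
proof -
  interpret pair_graph G by (rule G)
  have no_loop: "(v, v) \<notin> parcs G" for v using pair_no_loops[of "(v, v)"] by auto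
  define m where "m p = id(snd (g p) := fst (g p))" for p
  have "\<exists>u. \<forall>p\<in>S. p dvd u - c (m p v)" for v
    by (rule chinese_remainder_monic_irreducible[OF S, of "\<lambda>p. c (m p v)"]) auto
  then have "\<exists>u. \<forall>v. \<forall>p\<in>S. p dvd u v - c (m p v)"
    by (intro choice allI)
  then obtain u where u: "\<And>v p. p \<in> S \<Longrightarrow> p dvd u v - c (m p v)"
    by blast
  have dvd_iff: "p dvd u v - u w \<longleftrightarrow> p dvd c (m p v) - c (m p w)" if "p \<in> S" for p v w
  proof -
    have "p dvd (u v - c (m p v)) - (u w - c (m p w))"
      using dvd_diff[OF u[OF that, of v] u[OF that, of w]] .
    then have "p dvd (u v - u w) - (c (m p v) - c (m p w))"
      by (simp add: algebra_simps)
    then show ?thesis using dvd_diff_left_iff dvd_diff_right_iff by blast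
  qed
  have merged: "p dvd u v - u w \<longleftrightarrow> m p v = m p w"
    if "p \<in> S" "v \<in> pverts G" "w \<in> pverts G" for p v w
  proof -
    have "m p x \<in> pverts G" if "x \<in> pverts G" for x
      using in_verts[OF \<open>p \<in> S\<close>] that by (auto simp: m_def)
    then show ?thesis using dvd_iff distinct that by (metis diff_self dvd_0_right)
  qed
  have adj: "(v, w) \<in> parcs G \<longleftrightarrow> coprime (u v - u w) (\<Prod>S)"
    if vw: "v \<in> pverts G" "w \<in> pverts G" for v w
  proof
    assume arc: "(v, w) \<in> parcs G"
    have "m p v \<noteq> m p w" if "p \<in> S" for p
    proof
      assume "m p v = m p w"
      moreover have "v \<noteq> w" using arc no_loop by auto
      ultimately have "g p = (v, w) \<or> g p = (w, v)"
        by (cases "g p") (auto simp: m_def split: if_splits)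
      then show False
        using arc arcs_symmetric non_arc[OF that] by metis
    qed
    then show "coprime (u v - u w) (\<Prod>S)"
      using coprime_prod_monic_irreducible_iff[OF S] merged vw by blast
  next
    assume cop: "coprime (u v - u w) (\<Prod>S)"
    show "(v, w) \<in> parcs G"
    proof (rule ccontr)
      assume "(v, w) \<notin> parcs G"
      then obtain p where p: "p \<in> S" "(v, w) = g p" using all vw by blast
      have "m p v = m p w" by (simp add: m_def flip: p(2))
      then show False
        using coprime_prod_monic_irreducible_iff[OF S] cop merged vw p(1) by blast
    qed
  qed
  have "inj_on (\<lambda>v. residue_class (\<Prod>S) (u v)) (pverts G)"
  proof (rule inj_onI)
    fix v w assume vw: "v \<in> pverts G" "w \<in> pverts G"
      and "residue_class (\<Prod>S) (u v) = residue_class (\<Prod>S) (u w)"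
    then have dvd: "\<Prod>S dvd u v - u w"
      by (simp add: residue_class_eq_iff cong_iff_dvd_diff)
    obtain p where p: "p \<in> S" "(v, v) = g p" using all no_loop vw by blast
    have "p dvd u v - u w"
      using dvd dvd_prodI[OF S(1) p(1), of "\<lambda>p. p"] by (meson dvd_trans)
    then have "m p v = m p w" using merged p(1) vw by blast
    then show "v = w" by (simp add: m_def flip: p(2) split: if_splits)
  qed
  moreover have "residue_class F x \<in> pverts (unitary_cayley_graph F)" for F x :: "'a poly"
    by (simp add: unitary_cayley_graph_def residue_class_in_residue_classes)
  ultimately show ?thesis
    unfolding embeds_as_induced_subgraph_def
    by (intro exI[of _ "\<lambda>v. residue_class (\<Prod>S) (u v)"] conjI)
      (auto simp: parcs_unitary_cayley_graph_iff adj)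
qed

theorem proposition8p2:
  fixes G :: "'v pair_pre_digraph" and q :: nat
  assumes "pair_graph G"
    and "primepow q" and "card (UNIV :: 'a::{field, finite} set) = q"
  shows "\<exists>r>0. \<forall>d\<ge>r. \<exists>F :: 'a poly.
           lead_coeff F = 1 \<and> omega F = d \<and>
           embeds_as_induced_subgraph G (unitary_cayley_graph F)"
proof -
  interpret pair_graph G by (rule assms(1))
  have no_loop: "(v, v) \<notin> parcs G" for v using pair_no_loops[of "(v, v)"] by auto
  let ?V = "pverts G"
  obtain c :: "'v \<Rightarrow> 'a poly" where c: "inj_on c ?V"
    using ex_inj_on_poly[OF pair_finite_verts] by blast
  let ?D = "{x \<in> ?V \<times> ?V. fst x \<noteq> snd x}"
  define h where "h = (\<Prod>x\<in>?D. c (fst x) - c (snd x))"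
  have finD: "finite ?D" using pair_finite_verts by simp
  have "h \<noteq> 0" using c finD by (auto simp: h_def inj_on_def)
  \<comment> \<open>The additional diagonal pair keeps the set of pairs non-empty when \<open>G\<close> has no vertices.\<close>
  define A where "A = insert (undefined, undefined) ((?V \<times> ?V) - parcs G)"
  have finA: "finite A" using pair_finite_verts by (simp add: A_def)
  show ?thesis
  proof (intro exI[of _ "card A"] conjI allI impI)
    show "card A > 0" using finA by (auto simp: card_gt_0_iff A_def)
    fix d assume d: "card A \<le> d"
    obtain S where S: "finite S" "card S = d" "S \<subseteq> {p. monic_irreducible p \<and> \<not> p dvd h}"
      using infinite_arbitrarily_large[OF infinite_monic_irreducible_not_dvd[OF \<open>h \<noteq> 0\<close>], of d]
      by (elim exE conjE)
    then have irr: "monic_irreducible p" if "p \<in> S" for p using that by blast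
    have "A \<noteq> {}" by (simp add: A_def)
    moreover have "card A \<le> card S" using d S(2) by simp
    ultimately obtain g where g: "g ` S = A"
      by (rule finite_surj_of_card_le[OF finA _ S(1)])
    have distinct: "\<not> p dvd c v - c w" if "p \<in> S" "v \<in> ?V" "w \<in> ?V" "v \<noteq> w" for p v w
    proof
      assume "p dvd c v - c w"
      also have "c v - c w dvd h"
        using dvd_prodI[OF finD, of "(v, w)" "\<lambda>x. c (fst x) - c (snd x)"] that by (simp add: h_def)
      finally show False using S(3) that by blast
    qed
    have pair: "g p \<notin> parcs G" "fst (g p) = snd (g p) \<or> g p \<in> ?V \<times> ?V" if "p \<in> S" for p
    proof -
      have "g p \<in> A" using g that by blast
      then show "g p \<notin> parcs G" "fst (g p) = snd (g p) \<or> g p \<in> ?V \<times> ?V"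
        using no_loop by (auto simp: A_def)
    qed
    have all: "(?V \<times> ?V) - parcs G \<subseteq> g ` S" using g by (auto simp: A_def)
    have "embeds_as_induced_subgraph G (unitary_cayley_graph (\<Prod>S))"
      by (rule embeds_in_unitary_cayley_graph[OF assms(1) S(1) irr distinct pair all])
    moreover have "lead_coeff (\<Prod>S) = 1"
      using irr by (simp add: lead_coeff_prod)
    moreover have "omega (\<Prod>S) = d"
      using omega_prod_monic_irreducible[OF S(1) irr] S(2) by simp
    ultimately show "\<exists>F :: 'a poly. lead_coeff F = 1 \<and> omega F = d \<and>
        embeds_as_induced_subgraph G (unitary_cayley_graph F)" by blast
  qed
qed

end
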